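(* Let $k$ be an $F$-finite field of prime characteristic $p$, let $G$ be a simple connected graph on the vertex set $[d]=\{1,\dots,d\}$, and let $J_G\subseteq R=k[x_1,\dots,x_d,y_1,\dots,y_d]$ be the binomial edge ideal of $G$. If $|\operatorname{Ass}(J_G)|=2$, then $G$ is weakly closed.
   Context: A graph is simple if it is undirected, without loops and without multiple edges. For a simple graph $G$ with vertex set $[d]$ and edge set $E$, the binomial edge ideal is $J_G=(x_iy_j-x_jy_i \mid \{i,j\}\in E)\subseteq R$. $\operatorname{Ass}(J)$ denotes the set of associated primes of $R/J$. A field $k$ of characteristic $p$ is $F$-finite if $k$ is a finite extension of $k^p$. A simple graph with $d$ vertices and edge set $E$ is weakly closed if its vertices can be labeled by $[d]$ so that whenever $\{i,k\}\in E$ and $i<j<k$, then $\{i,j\}\in E$ or $\{j,k\}\in E$. *)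

theory Defs
  imports
    "HOL-Algebra.Algebra"
    "HOL-Algebra.Algebraic_Closure_Type"
    "HOL-Library.Poly_Mapping"
    "Graph_Theory.Graph_Theory"
begin

section \<open>F-finite fields\<close>

text \<open>
  For a field of prime characteristic \<open>p = CHAR('k)\<close>, the set \<open>range (\<lambda>x. x ^ p)\<close> is the
  subfield \<open>k\<^sup>p\<close>. The notion is only meaningful in that case.
\<close>
definition F_finite :: "'k::field itself \<Rightarrow> bool" where
  "F_finite (_ :: 'k itself) \<longleftrightarrow>
     ring.finite_dimension (ring_of_type_algebra :: 'k ring)
       (range (\<lambda>x :: 'k. x ^ CHAR('k))) UNIV"


section \<open>The polynomial ring in \<open>x\<^sub>1, \<dots>, x\<^sub>d, y\<^sub>1, \<dots>, y\<^sub>d\<close>\<close>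

datatype xy = Xv nat | Yv nat

text \<open>
  Polynomials are finitely supported coefficient functions on monomials, and monomials are finitely
  supported exponent functions; the product of \<^theory>\<open>HOL-Library.Poly_Mapping\<close> is convolution.
  The type has the variables \<open>Xv i\<close>, \<open>Yv i\<close> for all \<open>i\<close>, and \<open>xy_ring d\<close> below restricts the
  indices to \<open>{1..d}\<close>.
\<close>
type_synonym 'k xy_poly = "(xy \<Rightarrow>\<^sub>0 nat) \<Rightarrow>\<^sub>0 'k"

definition indet :: "xy \<Rightarrow> 'k::field xy_poly" where
  "indet v = Poly_Mapping.single (Poly_Mapping.single v 1) 1"

definition xy_ring :: "nat \<Rightarrow> 'k::field xy_poly ring" where
  "xy_ring d = ring_of_type_algebra
     \<lparr>carrier := {f. \<forall>m \<in> Poly_Mapping.keys f. Poly_Mapping.keys m \<subseteq> Xv ` {1..d} \<union> Yv ` {1..d}}\<rparr>"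

lemma xy_ring_simps [simp]:
  "monoid.mult (xy_ring d) f g = f * g" "monoid.one (xy_ring d) = 1"
  "ring.add (xy_ring d) f g = f + g" "ring.zero (xy_ring d) = 0"
  by (simp_all add: xy_ring_def ring_of_type_algebra_def)

lemma carrier_xy_ring:
  "carrier (xy_ring d) = {f. \<forall>m \<in> Poly_Mapping.keys f. Poly_Mapping.keys m \<subseteq> Xv ` {1..d} \<union> Yv ` {1..d}}"
  by (simp add: xy_ring_def)

lemma cring_xy_ring: "cring (xy_ring d :: 'k::field xy_poly ring)"
proof -
  let ?C = "carrier (xy_ring d :: 'k xy_poly ring)"
  have add: "f + g \<in> ?C" if "f \<in> ?C" "g \<in> ?C" for f g
    using that Poly_Mapping.keys_add[of f g] unfolding carrier_xy_ring by blast
  have uminus: "- f \<in> ?C" if "f \<in> ?C" for f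
    using that unfolding carrier_xy_ring by (simp add: Poly_Mapping.keys_def lookup_uminus)
  have mult: "f * g \<in> ?C" if f: "f \<in> ?C" and g: "g \<in> ?C" for f g
    unfolding carrier_xy_ring
  proof (intro CollectI ballI)
    fix m assume "m \<in> Poly_Mapping.keys (f * g)"
    then obtain a b where "m = a + b" "a \<in> Poly_Mapping.keys f" "b \<in> Poly_Mapping.keys g"
      using Poly_Mapping.keys_mult[of f g] by blast
    then show "Poly_Mapping.keys m \<subseteq> Xv ` {1..d} \<union> Yv ` {1..d}"
      using f g Poly_Mapping.keys_add[of a b] unfolding carrier_xy_ring by blast
  qed
  have zero: "0 \<in> ?C" and one: "1 \<in> ?C"
    by (simp_all add: carrier_xy_ring flip: single_one)
  have inv: "\<exists>g \<in> ?C. g + f = 0" if "f \<in> ?C" for f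
    using uminus[OF that] by (intro bexI[of _ "- f"]) auto
  have "abelian_group (xy_ring d :: 'k xy_poly ring)"
    by (rule abelian_groupI) (use add zero inv in \<open>auto simp: add.assoc add.commute\<close>)
  moreover have "Group.comm_monoid (xy_ring d :: 'k xy_poly ring)"
    by (rule comm_monoidI) (use mult one in \<open>auto simp: mult.assoc mult.commute\<close>)
  ultimately show ?thesis
    by (rule cringI) (simp add: distrib_right)
qed

lemma indet_in_xy_ring:
  assumes "i \<in> {1..d}"
  shows "indet (Xv i) \<in> carrier (xy_ring d)" "indet (Yv i) \<in> carrier (xy_ring d)"
  using assms by (auto simp: carrier_xy_ring indet_def)


section \<open>Associated primes\<close>

definition Ass :: "('a, 'm) ring_scheme \<Rightarrow> ('a, 'b, 'n) module_scheme \<Rightarrow> 'a set set" where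
  "Ass R M = {P. primeideal P R \<and>
     (\<exists>m \<in> carrier M. P = {r \<in> carrier R. r \<odot>\<^bsub>M\<^esub> m = \<zero>\<^bsub>M\<^esub>})}"

definition quotient_module :: "('a, 'm) ring_scheme \<Rightarrow> 'a set \<Rightarrow> ('a, 'a set) module" where
  "quotient_module R J = ring.extend (R Quot J)
     (module.fields (\<lambda>r A. (J +>\<^bsub>R\<^esub> r) \<otimes>\<^bsub>R Quot J\<^esub> A))"

lemma quotient_module_simps [simp]:
  "carrier (quotient_module R J) = carrier (R Quot J)"
  "monoid.mult (quotient_module R J) = monoid.mult (R Quot J)"
  "monoid.one (quotient_module R J) = monoid.one (R Quot J)"
  "ring.add (quotient_module R J) = ring.add (R Quot J)"
  "ring.zero (quotient_module R J) = ring.zero (R Quot J)"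
  "r \<odot>\<^bsub>quotient_module R J\<^esub> A = (J +>\<^bsub>R\<^esub> r) \<otimes>\<^bsub>R Quot J\<^esub> A"
  by (simp_all add: quotient_module_def ring.extend_def module.fields_def)

lemma module_quotient_module:
  assumes "cring R" "ideal J R"
  shows "module R (quotient_module R J)"
proof -
  interpret R: cring R by fact
  interpret J: ideal J R by fact
  interpret Q: cring "R Quot J" by (rule J.quotient_is_cring) fact
  interpret h: ring_hom_ring R "R Quot J" "\<lambda>r. J +>\<^bsub>R\<^esub> r" by (rule J.rcos_ring_hom_ring)
  show ?thesis
  proof (rule moduleI)
    show "abelian_group (quotient_module R J)"
    proof (rule abelian_groupI)
      fix A assume "A \<in> carrier (quotient_module R J)"
      then show "\<exists>B \<in> carrier (quotient_module R J).
          B \<oplus>\<^bsub>quotient_module R J\<^esub> A = \<zero>\<^bsub>quotient_module R J\<^esub>"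
        by (intro bexI[of _ "\<ominus>\<^bsub>R Quot J\<^esub> A"]) (auto simp: Q.l_neg)
    qed (simp_all add: Q.a_ac)
  qed (use Q.m_assoc Q.l_distr Q.r_distr h.hom_one in
        \<open>auto simp: R.is_cring h.hom_add h.hom_mult\<close>)
qed


section \<open>Graphs\<close>

text \<open>
  A finite simple graph is a \<^locale>\<open>pair_graph\<close>: an edge \<open>{i,j}\<close> is represented by the two arcs
  \<open>(i,j)\<close> and \<open>(j,i)\<close>. Both arcs contribute a generator below; the two differ by a sign.
\<close>
definition binomial_edge_ideal :: "nat \<Rightarrow> nat pair_pre_digraph \<Rightarrow> 'k::field xy_poly set" where
  "binomial_edge_ideal d G = genideal (xy_ring d)
     {indet (Xv i) * indet (Yv j) - indet (Xv j) * indet (Yv i) | i j. (i, j) \<in> parcs G}"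

lemma ideal_binomial_edge_ideal:
  assumes "pair_graph G" "pverts G = {1..d}"
  shows "ideal (binomial_edge_ideal d G :: 'k::field xy_poly set) (xy_ring d)"
proof -
  interpret pair_graph G by fact
  interpret R: cring "xy_ring d :: 'k xy_poly ring" by (rule cring_xy_ring)
  have minus: "f - g = f \<ominus>\<^bsub>xy_ring d\<^esub> g"
    if "f \<in> carrier (xy_ring d)" "g \<in> carrier (xy_ring d)" for f g :: "'k xy_poly"
  proof -
    have "(f \<ominus>\<^bsub>xy_ring d\<^esub> g) \<oplus>\<^bsub>xy_ring d\<^esub> g = f"
      using that by (simp add: R.minus_eq R.a_assoc R.l_neg del: xy_ring_simps(3,4))
    then show ?thesis by (simp add: eq_diff_eq[symmetric])
  qed
  have "indet (Xv i) * indet (Yv j) - indet (Xv j) * indet (Yv i)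
      \<in> carrier (xy_ring d :: 'k xy_poly ring)" if "(i, j) \<in> parcs G" for i j
  proof -
    have "i \<in> {1..d}" "j \<in> {1..d}"
      using that wellformed' assms(2) by blast+
    then have "indet (Xv i) * indet (Yv j) \<in> carrier (xy_ring d :: 'k xy_poly ring)"
      "indet (Xv j) * indet (Yv i) \<in> carrier (xy_ring d :: 'k xy_poly ring)"
      using R.m_closed[simplified] indet_in_xy_ring by metis+
    then show ?thesis
      using minus R.minus_closed by metis
  qed
  then show ?thesis
    unfolding binomial_edge_ideal_def by (intro R.genideal_ideal) blast
qed

text \<open>The bijection \<open>l\<close> is the relabelling of the vertices.\<close>
definition weakly_closed :: "'a pair_pre_digraph \<Rightarrow> bool" where
  "weakly_closed G \<longleftrightarrow>
     (\<exists>l :: 'a \<Rightarrow> nat. bij_betw l (pverts G) {1..card (pverts G)} \<and>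
        (\<forall>i \<in> pverts G. \<forall>j \<in> pverts G. \<forall>k \<in> pverts G.
           (i, k) \<in> parcs G \<and> l i < l j \<and> l j < l k \<longrightarrow>
           (i, j) \<in> parcs G \<or> (j, k) \<in> parcs G))"

end

theory Submission
  imports Defs
begin

text \<open>
  Call \<open>S\<close> a cut set if every \<open>t \<in> S\<close> has neighbours in two different components of \<open>G - S\<close>, and let
  \<open>P\<^sub>S\<close> be the kernel of \<open>x\<^sub>i \<mapsto> t\<^sub>i z\<^sub>C\<close>, \<open>y\<^sub>i \<mapsto> t\<^sub>i w\<^sub>C\<close> (\<open>i\<close> in the component \<open>C\<close> of \<open>G - S\<close>) and
  \<open>x\<^sub>i, y\<^sub>i \<mapsto> 0\<close> (\<open>i \<in> S\<close>). It is a prime containing \<open>J\<^sub>G\<close>, and it is generated by the variables of \<open>S\<close> and the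
  binomials \<open>f\<^sub>a\<^sub>b = x\<^sub>a y\<^sub>b - x\<^sub>b y\<^sub>a\<close> with \<open>a\<close>, \<open>b\<close> in one component. If \<open>u\<close>, \<open>v\<close> are neighbours of \<open>t\<close> in
  different components, then \<open>f\<^sub>u\<^sub>v \<notin> P\<^sub>S\<close> multiplies \<open>x\<^sub>t\<close> and \<open>y\<^sub>t\<close> into \<open>J\<^sub>G\<close>; and by
  \<open>x\<^sub>c f\<^sub>a\<^sub>b = x\<^sub>b f\<^sub>a\<^sub>c + x\<^sub>a f\<^sub>c\<^sub>b\<close> a power of the product of the \<open>x\<^sub>c\<close>, \<open>c \<notin> S\<close>, multiplies every generator \<open>f\<^sub>a\<^sub>b\<close>
  into \<open>J\<^sub>G\<close>. The product \<open>s\<close> of these multipliers satisfies \<open>(J\<^sub>G : s) = P\<^sub>S\<close>, so \<open>P\<^sub>S\<close> is associated,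
  without any appeal to Groebner bases or to \<open>J\<^sub>G\<close> being radical.

  Since \<open>S\<close> can be read off from \<open>P\<^sub>S\<close> and \<open>S = {}\<close> is a cut set, two associated primes leave room for at
  most one nonempty cut set \<open>S\<close>. A minimal separator of two nonadjacent vertices is a nonempty cut set, hence
  equal to \<open>S\<close>. So the vertices of \<open>S\<close> are adjacent to all others and the components of \<open>G - S\<close> are
  complete; labelling \<open>S\<close> first and then the components one after the other shows that \<open>G\<close> is weakly
  closed.
\<close>

section \<open>Cut sets of graphs\<close>

text \<open>Vertices of \<open>S\<close> are kept but isolated: for symmetric \<open>E\<close>, the
  classes of the reflexive transitive closure are the components of \<open>G - S\<close> and the
  singletons from \<open>S\<close>.\<close>

definition avoiding :: "'a set \<Rightarrow> 'a rel \<Rightarrow> 'a rel" where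
  "avoiding S E = {(a, b) \<in> E. a \<notin> S \<and> b \<notin> S}"

text \<open>For a graph this is the cut point property: restoring any single vertex of
  \<open>S\<close> joins at least two components of \<open>G - S\<close>.\<close>

definition cut_set :: "'a set \<Rightarrow> 'a rel \<Rightarrow> 'a set \<Rightarrow> bool" where
  "cut_set V E S \<longleftrightarrow> S \<subseteq> V \<and>
     (\<forall>t \<in> S. \<exists>u v. (t, u) \<in> E \<and> (t, v) \<in> E \<and> u \<notin> S \<and> v \<notin> S \<and> (u, v) \<notin> (avoiding S E)\<^sup>*)"

lemma sym_avoiding: "sym E \<Longrightarrow> sym (avoiding S E)"
  unfolding avoiding_def sym_def by blast

lemma avoiding_rtrancl_notin:
  assumes "(a, b) \<in> (avoiding S E)\<^sup>*" "a \<notin> S"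
  shows "b \<notin> S"
  using assms by (induction rule: rtrancl_induct) (auto simp: avoiding_def)

lemma cut_set_empty: "cut_set V E {}"
  by (simp add: cut_set_def)

text \<open>Until the path from \<open>a\<close> meets \<open>t\<close>, it stays in the component
  of \<open>a\<close> in \<open>G - T\<close>; the vertex before its first visit to \<open>t\<close>
  serves as \<open>u\<close>.\<close>

lemma reconnect_neighbour:
  assumes "sym E" "(a, b) \<in> (avoiding (T - {t}) E)\<^sup>*" "(a, b) \<notin> (avoiding T E)\<^sup>*" "a \<notin> T"
  obtains u where "(t, u) \<in> E" "(a, u) \<in> (avoiding T E)\<^sup>*"
proof -
  have "(a, b) \<in> (avoiding T E)\<^sup>* \<or> (\<exists>u. (t, u) \<in> E \<and> (a, u) \<in> (avoiding T E)\<^sup>*)"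
    using assms(2)
  proof (induction rule: rtrancl_induct)
    case base
    then show ?case by simp
  next
    case (step x y)
    show ?case
    proof (cases "(a, x) \<in> (avoiding T E)\<^sup>*")
      case True
      have "x \<notin> T" by (rule avoiding_rtrancl_notin[OF True assms(4)])
      have xy: "(x, y) \<in> E" "y \<notin> T - {t}" using step by (auto simp: avoiding_def)
      show ?thesis
      proof (cases "y = t")
        case True
        then have "(t, x) \<in> E" using xy assms(1) by (auto dest: symD)
        then show ?thesis using \<open>(a, x) \<in> (avoiding T E)\<^sup>*\<close> by blast
      next
        case False
        then have "(x, y) \<in> avoiding T E"
          using xy \<open>x \<notin> T\<close> by (auto simp: avoiding_def)
        then show ?thesis using True by (auto intro: rtrancl_into_rtrancl)
      qed
    next
      case False
      then show ?thesis using step by blast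
    qed
  qed
  then show ?thesis using assms(3) that by blast
qed

text \<open>A separator of least cardinality works: putting back \<open>t\<close> reconnects
  \<open>a\<close> and \<open>b\<close>, so \<open>t\<close> has a neighbour in the component of
  each.\<close>

lemma ex_separating_cut_set:
  assumes "finite V" "sym E" "E \<subseteq> V \<times> V" "a \<in> V" "b \<in> V" "a \<noteq> b" "(a, b) \<notin> E"
  obtains T where "cut_set V E T" "a \<notin> T" "b \<notin> T" "(a, b) \<notin> (avoiding T E)\<^sup>*"
proof -
  define sep where "sep T \<longleftrightarrow> T \<subseteq> V - {a, b} \<and> (a, b) \<notin> (avoiding T E)\<^sup>*" for T
  \<comment> \<open>Separators exist: deleting all vertices except \<open>a\<close> and
    \<open>b\<close> isolates \<open>a\<close>, since the two are not adjacent.\<close>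
  have "x = a" if "(a, x) \<in> (avoiding (V - {a, b}) E)\<^sup>*" for x
    using that assms(3,7) by (induction rule: rtrancl_induct) (auto simp: avoiding_def)
  then have "(a, b) \<notin> (avoiding (V - {a, b}) E)\<^sup>*" using assms(6) by blast
  then have "sep (V - {a, b})" by (simp add: sep_def)
  then obtain T where T: "sep T" and min: "\<And>T'. sep T' \<Longrightarrow> card T \<le> card T'"
    using ex_has_least_nat[of sep _ card] by blast
  have finT: "finite T" using T assms(1) finite_subset unfolding sep_def by blast
  have ab: "a \<notin> T" "b \<notin> T" "(a, b) \<notin> (avoiding T E)\<^sup>*" using T by (auto simp: sep_def)
  have symT: "sym ((avoiding T E)\<^sup>*)" by (intro sym_rtrancl sym_avoiding assms)
  have "\<exists>u v. (t, u) \<in> E \<and> (t, v) \<in> E \<and> u \<notin> T \<and> v \<notin> T \<and> (u, v) \<notin> (avoiding T E)\<^sup>*"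
    if t: "t \<in> T" for t
  proof -
    have "\<not> sep (T - {t})" using min[of "T - {t}"] card_Diff1_less[OF finT t] by auto
    then have conn: "(a, b) \<in> (avoiding (T - {t}) E)\<^sup>*" using T by (auto simp: sep_def)
    obtain u where u: "(t, u) \<in> E" "(a, u) \<in> (avoiding T E)\<^sup>*"
      by (rule reconnect_neighbour[OF assms(2) conn ab(3,1)])
    have conn': "(b, a) \<in> (avoiding (T - {t}) E)\<^sup>*"
      using conn sym_rtrancl[OF sym_avoiding[OF assms(2)]] by (blast dest: symD)
    have "(b, a) \<notin> (avoiding T E)\<^sup>*" using ab(3) symT by (blast dest: symD)
    then obtain v where v: "(t, v) \<in> E" "(b, v) \<in> (avoiding T E)\<^sup>*"
      using reconnect_neighbour[OF assms(2) conn' _ ab(2)] by blast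
    have "(u, v) \<notin> (avoiding T E)\<^sup>*"
    proof
      assume "(u, v) \<in> (avoiding T E)\<^sup>*"
      then have "(a, v) \<in> (avoiding T E)\<^sup>*" using u by auto
      moreover have "(v, b) \<in> (avoiding T E)\<^sup>*" using v symT by (blast dest: symD)
      ultimately show False using ab(3) by (metis rtrancl_trans)
    qed
    then show ?thesis
      using u v avoiding_rtrancl_notin ab by metis
  qed
  then have "cut_set V E T" using T by (auto simp: cut_set_def sep_def)
  then show ?thesis using that ab by blast
qed

section \<open>Labellings that witness weak closedness\<close>

lemma ex_ranking:
  fixes key :: "'a \<Rightarrow> nat"
  assumes "finite V" "inj_on key V"
  obtains l :: "'a \<Rightarrow> nat" where "bij_betw l V {1..card V}"
    "\<And>v w. v \<in> V \<Longrightarrow> w \<in> V \<Longrightarrow> l v < l w \<Longrightarrow> key v < key w"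
proof -
  \<comment> \<open>The rank counts \<open>v\<close> itself, so ranks start at 1.\<close>
  define l where "l v = card {w \<in> V. key w \<le> key v}" for v
  have mono: "l v \<le> l w" if "key v \<le> key w" for v w
    unfolding l_def by (rule card_mono) (use assms that in auto)
  have strict: "l v < l w" if "v \<in> V" "w \<in> V" "key v < key w" for v w
  proof -
    have "w \<in> {x \<in> V. key x \<le> key w}" "w \<notin> {x \<in> V. key x \<le> key v}" using that by auto
    moreover have "{x \<in> V. key x \<le> key v} \<subseteq> {x \<in> V. key x \<le> key w}" using that by auto
    ultimately show ?thesis
      unfolding l_def using assms(1) by (intro psubset_card_mono) (simp, blast)
  qed
  have "inj_on l V"
    by (rule inj_onI) (metis assms(2) inj_onD less_irrefl linorder_neqE_nat strict)
  moreover have "l ` V \<subseteq> {1..card V}"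
  proof
    fix y assume "y \<in> l ` V"
    then obtain v where v: "v \<in> V" "y = l v" by blast
    have "l v \<le> card V" unfolding l_def by (rule card_mono) (use assms in auto)
    moreover have "l v > 0" using v assms by (auto simp: l_def card_gt_0_iff)
    ultimately show "y \<in> {1..card V}" using v by auto
  qed
  ultimately have "bij_betw l V {1..card V}"
    by (simp add: bij_betw_def card_image card_subset_eq)
  then show ?thesis
    using that mono by (metis linorder_not_less)
qed

lemma (in pair_graph) weakly_closed_if_ordered:
  fixes key :: "'a \<Rightarrow> nat"
  assumes "inj_on key (pverts G)"
    and "\<And>i j k. (i, k) \<in> parcs G \<Longrightarrow> j \<in> pverts G \<Longrightarrow> key i < key j \<Longrightarrow> key j < key k
      \<Longrightarrow> (i, j) \<in> parcs G \<or> (j, k) \<in> parcs G"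
  shows "weakly_closed G"
proof -
  have "finite (pverts G)" by (rule pair_finite_verts)
  from ex_ranking[OF this assms(1)] obtain l :: "'a \<Rightarrow> nat" where
    "bij_betw l (pverts G) {1..card (pverts G)}"
    "\<And>v w. v \<in> pverts G \<Longrightarrow> w \<in> pverts G \<Longrightarrow> l v < l w \<Longrightarrow> key v < key w" by blast
  then show ?thesis
    unfolding weakly_closed_def using assms(2) by (intro exI[of _ l]) blast
qed

lemma sym_parcs:
  assumes "pair_graph G"
  shows "sym (parcs G)"
proof -
  interpret pair_graph G by fact
  show ?thesis using pair_sym_arcs by (simp add: symmetric_def)
qed

text \<open>The least vertex names its component; a vertex of \<open>S\<close> represents
  itself.\<close>

definition component_rep :: "'a set \<Rightarrow> 'a rel \<Rightarrow> 'a::wellorder \<Rightarrow> 'a" where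
  "component_rep S E a = (LEAST b. (a, b) \<in> (avoiding S E)\<^sup>*)"

lemma component_rep_conn: "(a, component_rep S E a) \<in> (avoiding S E)\<^sup>*"
  unfolding component_rep_def by (rule LeastI[of _ a]) simp

lemma component_rep_eq_iff:
  assumes "sym E"
  shows "component_rep S E a = component_rep S E b \<longleftrightarrow> (a, b) \<in> (avoiding S E)\<^sup>*"
proof
  have symT: "sym ((avoiding S E)\<^sup>*)" by (intro sym_rtrancl sym_avoiding assms)
  { assume "component_rep S E a = component_rep S E b"
    then show "(a, b) \<in> (avoiding S E)\<^sup>*"
      using component_rep_conn[of a S E] component_rep_conn[of b S E] symT
      by (metis rtrancl_trans symD) }
  { assume "(a, b) \<in> (avoiding S E)\<^sup>*"
    then have "(a, c) \<in> (avoiding S E)\<^sup>* \<longleftrightarrow> (b, c) \<in> (avoiding S E)\<^sup>*" for c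
      using symT by (metis rtrancl_trans symD)
    then show "component_rep S E a = component_rep S E b"
      by (simp add: component_rep_def) }
qed

text \<open>Every nonadjacent pair is separated by the one nonempty cut set \<open>S\<close>. With
  \<open>S\<close> sorted first and each component contiguous, an edge from \<open>i\<close> to
  \<open>k\<close> forces the edge from \<open>i\<close> to \<open>j\<close>.\<close>

lemma weakly_closed_if_unique_cut_set:
  assumes "pair_graph G" "pverts G = {1..d::nat}" "Digraph_Component.connected (with_proj G)"
    and uniq: "\<And>S T. \<lbrakk>cut_set {1..d} (parcs G) S; cut_set {1..d} (parcs G) T; S \<noteq> {}; T \<noteq> {}\<rbrakk>
      \<Longrightarrow> S = T"
  shows "weakly_closed G"
proof -
  interpret pair_graph G by fact
  let ?V = "{1..d}"
  let ?E = "parcs G"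
  have symE: "sym ?E" by (rule sym_parcs) fact
  have EV: "?E \<subseteq> ?V \<times> ?V" using wellformed' assms(2) by auto
  have conn: "(a, b) \<in> ?E\<^sup>*" if "a \<in> ?V" "b \<in> ?V" for a b
  proof -
    have "(a, b) \<in> rtrancl_on ?V (?E\<^sup>s)"
      using assms(3) that unfolding connected_conv by (simp add: assms(2))
    then have "(a, b) \<in> (?E\<^sup>s)\<^sup>*" by (rule rtrancl_on_rtranclI)
    moreover have "?E\<^sup>s = ?E" using symE by (auto simp: symcl_def dest: symD)
    ultimately show ?thesis by simp
  qed
  show ?thesis
  proof (cases "\<exists>a b. a \<in> ?V \<and> b \<in> ?V \<and> a \<noteq> b \<and> (a, b) \<notin> ?E")
    \<comment> \<open>In a complete graph every order works.\<close>
    case False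
    show ?thesis
    proof (rule weakly_closed_if_ordered[of id])
      fix i j k assume "(i, k) \<in> ?E" "j \<in> pverts G" "id i < id j"
      then have "i \<in> ?V" "j \<in> ?V" "i \<noteq> j" using EV assms(2) by auto
      then show "(i, j) \<in> ?E \<or> (j, k) \<in> ?E" using False by blast
    qed simp
  next
    case True
    have sep: "\<exists>T. cut_set ?V ?E T \<and> T \<noteq> {} \<and> a \<notin> T \<and> b \<notin> T \<and> (a, b) \<notin> (avoiding T ?E)\<^sup>*"
      if ab: "a \<in> ?V" "b \<in> ?V" "a \<noteq> b" "(a, b) \<notin> ?E" for a b
    proof -
      obtain T where T: "cut_set ?V ?E T" "a \<notin> T" "b \<notin> T" "(a, b) \<notin> (avoiding T ?E)\<^sup>*"
        using ex_separating_cut_set[OF _ symE EV ab] by auto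
      have "avoiding {} ?E = ?E" by (simp add: avoiding_def)
      \<comment> \<open>With \<open>T\<close> empty nothing is removed, and connectedness would join
        \<open>a\<close> to \<open>b\<close>.\<close>
      then have "T \<noteq> {}" using T conn[OF ab(1,2)] by metis
      then show ?thesis using T by blast
    qed
    obtain S where S: "cut_set ?V ?E S" "S \<noteq> {}" using True sep by blast
    have nonadj: "a \<notin> S \<and> b \<notin> S \<and> (a, b) \<notin> (avoiding S ?E)\<^sup>*"
      if "a \<in> ?V" "b \<in> ?V" "a \<noteq> b" "(a, b) \<notin> ?E" for a b
      using sep[OF that] uniq[OF S(1) _ S(2)] by auto
    define rep where "rep = component_rep S ?E"
    \<comment> \<open>Vertices start at 1, so the value 0 is free to place \<open>S\<close> before
      all components.\<close>
    define major where "major v = (if v \<in> S then 0 else rep v)" for v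
    have major0: "major v = 0 \<longleftrightarrow> v \<in> S" if "v \<in> ?V" for v
    proof -
      have "(v, rep v) \<in> (avoiding S ?E)\<^sup>*" unfolding rep_def by (rule component_rep_conn)
      then have "rep v \<in> ?V" using that EV
        by (induction rule: rtrancl_induct) (auto simp: avoiding_def)
      then show ?thesis by (auto simp: major_def)
    qed
    \<comment> \<open>The lexicographic order by \<open>major\<close>, then by label.\<close>
    define key where "key v = major v * (d + 1) + v" for v
    have key_less: "major v \<le> major w" if "v \<in> ?V" "w \<in> ?V" "key v < key w" for v w
    proof (rule ccontr)
      assume "\<not> major v \<le> major w"
      then have "(major w + 1) * (d + 1) \<le> major v * (d + 1)" by (intro mult_right_mono) auto
      then show False using that by (simp add: key_def)
    qed
    have key_mod: "key v mod (d + 1) = v" if "v \<in> ?V" for v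
      using that by (auto simp: key_def simp del: mult_Suc_right add_Suc_right)
    have "inj_on key ?V"
      by (rule inj_onI) (metis key_mod)
    show ?thesis
    proof (rule weakly_closed_if_ordered[of key])
      show "inj_on key (pverts G)" using \<open>inj_on key ?V\<close> assms(2) by simp
      fix i j k assume ik: "(i, k) \<in> ?E" and "j \<in> pverts G" and less: "key i < key j" "key j < key k"
      then have V: "i \<in> ?V" "j \<in> ?V" "k \<in> ?V" using EV assms(2) by auto
      have "i \<noteq> j" using less by auto
      have le: "major i \<le> major j" "major j \<le> major k" using key_less V less by auto
      have "(i, j) \<in> ?E"
      proof (rule ccontr)
        assume "(i, j) \<notin> ?E"
        then have *: "i \<notin> S" "j \<notin> S" "(i, j) \<notin> (avoiding S ?E)\<^sup>*"
          using nonadj V \<open>i \<noteq> j\<close> by auto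
        \<comment> \<open>As \<open>i\<close> is outside \<open>S\<close>, \<open>major i\<close> is
          positive, and \<open>major k\<close> is at least as large.\<close>
        then have "k \<notin> S" using le major0 V by (metis le_zero_eq)
        then have "(i, k) \<in> (avoiding S ?E)\<^sup>*" using ik * by (auto simp: avoiding_def)
        then have "rep i = rep k" unfolding rep_def component_rep_eq_iff[OF symE] .
        \<comment> \<open>\<open>major j\<close> is squeezed between the equal values
          \<open>major i\<close> and \<open>major k\<close>.\<close>
        then have "rep i = rep j" using le * \<open>k \<notin> S\<close> by (simp add: major_def)
        then show False using * unfolding rep_def component_rep_eq_iff[OF symE] by simp
      qed
      then show "(i, j) \<in> ?E \<or> (j, k) \<in> ?E" by simp
    qed
  qed
qed


section \<open>Linear extension of maps on monomials\<close>

abbreviation keys :: "('a \<Rightarrow>\<^sub>0 'b::zero) \<Rightarrow> 'a set" where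
  "keys \<equiv> Poly_Mapping.keys"

abbreviation lookup :: "('a \<Rightarrow>\<^sub>0 'b::zero) \<Rightarrow> 'a \<Rightarrow> 'b" where
  "lookup \<equiv> Poly_Mapping.lookup"

text \<open>Scalars act as constant polynomials \<open>single 0 c\<close>. The map serves twice: for
  polynomials over a field, and with natural coefficients for exponent vectors.\<close>

definition lin_ext :: "('a \<Rightarrow> ('b::comm_monoid_add \<Rightarrow>\<^sub>0 'k::comm_semiring_1)) \<Rightarrow> ('a \<Rightarrow>\<^sub>0 'k) \<Rightarrow> ('b \<Rightarrow>\<^sub>0 'k)"
  where "lin_ext g f = (\<Sum>m \<in> keys f. Poly_Mapping.single 0 (lookup f m) * g m)"

lemma lin_ext_superset:
  assumes "finite A" "keys f \<subseteq> A"
  shows "lin_ext g f = (\<Sum>m \<in> A. Poly_Mapping.single 0 (lookup f m) * g m)"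
  unfolding lin_ext_def
  by (rule sum.mono_neutral_left) (use assms in \<open>auto simp: in_keys_iff\<close>)

lemma lin_ext_add: "lin_ext g (f + f') = lin_ext g f + lin_ext g f'"
proof -
  let ?A = "keys f \<union> keys f'"
  have "keys (f + f') \<subseteq> ?A" by (rule Poly_Mapping.keys_add)
  then show ?thesis
    by (simp add: lin_ext_superset[of ?A] lookup_add single_add distrib_right sum.distrib)
qed

lemma lin_ext_single: "lin_ext g (Poly_Mapping.single m c) = Poly_Mapping.single 0 c * g m"
  by (simp add: lin_ext_def)

lemma lin_ext_single_Suc_0 [simp]: "lin_ext g (Poly_Mapping.single v (Suc 0)) = g v"
  unfolding lin_ext_single One_nat_def[symmetric] single_one by (rule mult_1_left)

lemma lin_ext_zero [simp]: "lin_ext g 0 = 0"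
  by (simp add: lin_ext_def)

lemma lin_ext_diff:
  fixes f f' :: "'a \<Rightarrow>\<^sub>0 'k::comm_ring_1"
  shows "lin_ext g (f - f') = lin_ext g f - lin_ext g f'"
  using lin_ext_add[of g "f - f'" f'] by simp

lemma lin_ext_sum: "lin_ext g (\<Sum>i \<in> A. f i) = (\<Sum>i \<in> A. lin_ext g (f i))"
  by (induction A rule: infinite_finite_induct) (auto simp: lin_ext_add)

lemma poly_mapping_sum_single:
  fixes f :: "'a \<Rightarrow>\<^sub>0 'b::comm_monoid_add"
  shows "f = (\<Sum>m \<in> keys f. Poly_Mapping.single m (lookup f m))"
proof (rule poly_mapping_eqI)
  fix k
  show "lookup f k = lookup (\<Sum>m \<in> keys f. Poly_Mapping.single m (lookup f m)) k"
    by (simp add: lookup_sum lookup_single when_def in_keys_iff)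
qed

text \<open>Both sides are bilinear, so multiplicativity on monomials suffices.\<close>

lemma lin_ext_mult:
  fixes f f' :: "'a::comm_monoid_add \<Rightarrow>\<^sub>0 'k::comm_semiring_1"
  assumes "\<And>m n. g (m + n) = g m * g n"
  shows "lin_ext g (f * f') = lin_ext g f * lin_ext g f'"
proof -
  have single: "lin_ext g (Poly_Mapping.single m c * Poly_Mapping.single n c')
      = lin_ext g (Poly_Mapping.single m c) * lin_ext g (Poly_Mapping.single n c')" for m n c c'
  proof -
    have "Poly_Mapping.single (0::'b) (c * c') = Poly_Mapping.single 0 c * Poly_Mapping.single 0 c'"
      by (simp add: mult_single)
    then show ?thesis
      unfolding mult_single[of m] lin_ext_single assms by (simp only: mult_ac)
  qed
  have "lin_ext g (f * f') =
      lin_ext g ((\<Sum>m \<in> keys f. Poly_Mapping.single m (lookup f m)) *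
                 (\<Sum>n \<in> keys f'. Poly_Mapping.single n (lookup f' n)))"
    by (simp flip: poly_mapping_sum_single)
  also have "\<dots> = lin_ext g (\<Sum>m \<in> keys f. Poly_Mapping.single m (lookup f m)) *
                 lin_ext g (\<Sum>n \<in> keys f'. Poly_Mapping.single n (lookup f' n))"
    by (simp only: sum_product lin_ext_sum single)
  finally show ?thesis by (simp flip: poly_mapping_sum_single)
qed

lemma single_1_neq_0 [simp]: "Poly_Mapping.single m (1::'b::zero_neq_one) \<noteq> 0"
  by (metis lookup_single_eq lookup_zero zero_neq_one)

lemma lookup_const_mult: "lookup (Poly_Mapping.single 0 c * p) k = c * lookup p k"
  unfolding mult_map_scale_conv_mult[symmetric] by (simp add: map.rep_eq when_def)

lemma lookup_lin_ext: "lookup (lin_ext g f) k = (\<Sum>m \<in> keys f. lookup f m * lookup (g m) k)"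
  by (simp add: lin_ext_def lookup_sum lookup_const_mult)

lemma lookup_lin_ext_neq_0:
  assumes "lookup (lin_ext g f) k \<noteq> 0"
  obtains m where "m \<in> keys f" "lookup (g m) k \<noteq> 0"
proof -
  obtain m where "m \<in> keys f" "lookup f m * lookup (g m) k \<noteq> 0"
    using assms unfolding lookup_lin_ext by (rule sum.not_neutral_contains_not_neutral)
  moreover from this have "lookup (g m) k \<noteq> 0" by (intro notI) simp
  ultimately show thesis using that by blast
qed

lemma keys_add_nat:
  "keys (m + n) = keys m \<union> keys (n :: 'a \<Rightarrow>\<^sub>0 nat)"
  by (auto simp: in_keys_iff lookup_add)

lemma monomial_split:
  fixes m :: "'a \<Rightarrow>\<^sub>0 nat"
  assumes "v \<in> keys m"
  obtains n where "m = n + Poly_Mapping.single v 1"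
proof
  show "m = m - Poly_Mapping.single v 1 + Poly_Mapping.single v 1"
    using assms by (intro poly_mapping_eqI) (auto simp: lookup_add lookup_minus lookup_single when_def in_keys_iff)
qed

text \<open>Induction on the total degree.\<close>

lemma monomial_induct [case_names zero add]:
  fixes m :: "'a \<Rightarrow>\<^sub>0 nat"
  assumes "P 0" and step: "\<And>n v. P n \<Longrightarrow> P (n + Poly_Mapping.single v 1)"
  shows "P m"
proof (induction "\<Sum>v \<in> keys m. lookup m v" arbitrary: m)
  case 0
  then have "m = 0" by (intro poly_mapping_eqI) (auto simp: in_keys_iff)
  then show ?case using assms(1) by simp
next
  case (Suc k)
  then have "keys m \<noteq> {}" by auto
  then obtain v where "v \<in> keys m" by blast
  then obtain n where n: "m = n + Poly_Mapping.single v 1" by (rule monomial_split)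
  let ?A = "keys m"
  have "(\<Sum>w \<in> ?A. lookup m w) = (\<Sum>w \<in> ?A. lookup n w) + (\<Sum>w \<in> ?A. lookup (Poly_Mapping.single v 1) w)"
    by (simp add: n lookup_add sum.distrib)
  also have "(\<Sum>w \<in> ?A. lookup (Poly_Mapping.single v (1::nat)) w) = 1"
    using \<open>v \<in> ?A\<close> by (simp add: lookup_single when_def)
  also have "(\<Sum>w \<in> ?A. lookup n w) = (\<Sum>w \<in> keys n. lookup n w)"
    by (rule sum.mono_neutral_right) (auto simp: n keys_add_nat in_keys_iff)
  finally show ?case using Suc step n by simp
qed


section \<open>The prime ideal of a cut set\<close>

text \<open>The colon ideal \<open>(J : s)\<close> is the annihilator of the class of
  \<open>s\<close> in \<open>R/J\<close>.\<close>

lemma (in cring) annihilator_in_Ass: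
  assumes J: "ideal J R" and P: "primeideal P R" and s: "s \<in> carrier R"
    and ann: "P = {r \<in> carrier R. r \<otimes> s \<in> J}"
  shows "P \<in> Ass R (quotient_module R J)"
proof -
  interpret J: ideal J R by fact
  have iff: "J +> r = J \<longleftrightarrow> r \<in> J" if "r \<in> carrier R" for r
    using that J.a_rcos_const J.a_rcos_self by blast
  have "r \<odot>\<^bsub>quotient_module R J\<^esub> (J +> s) = \<zero>\<^bsub>quotient_module R J\<^esub> \<longleftrightarrow> r \<otimes> s \<in> J"
    if "r \<in> carrier R" for r
    using that s iff[of "r \<otimes> s"] by (simp add: FactRing_def J.rcoset_mult_add)
  moreover have "J +> s \<in> carrier (quotient_module R J)"
    using s by (simp add: FactRing_def a_rcosetsI J.a_subset)
  ultimately show ?thesis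
    unfolding Ass_def using P ann by blast
qed

section \<open>The parametrization attached to a vertex set\<close>

definition edge_binomial :: "nat \<Rightarrow> nat \<Rightarrow> 'k::field xy_poly" where
  "edge_binomial i j = indet (Xv i) * indet (Yv j) - indet (Xv j) * indet (Yv i)"

definition vars :: "nat set \<Rightarrow> xy set" where
  "vars A = Xv ` A \<union> Yv ` A"

lemma vars_iff [simp]: "Xv i \<in> vars A \<longleftrightarrow> i \<in> A" "Yv i \<in> vars A \<longleftrightarrow> i \<in> A"
  by (auto simp: vars_def)

text \<open>
  The substitution \<open>x\<^sub>i \<mapsto> t\<^sub>i z\<^sub>C\<close>, \<open>y\<^sub>i \<mapsto> t\<^sub>i w\<^sub>C\<close>, where \<open>C\<close> is the component of \<open>i\<close>. The three families of
  variables \<open>t\<close>, \<open>z\<close>, \<open>w\<close> are coded by the residues modulo 3, and \<open>r\<close> picks a representative of the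
  component.
\<close>
fun var_exp :: "(nat \<Rightarrow> nat) \<Rightarrow> xy \<Rightarrow> (nat \<Rightarrow>\<^sub>0 nat)" where
  "var_exp r (Xv i) = Poly_Mapping.single (3 * i) 1 + Poly_Mapping.single (3 * r i + 1) 1"
| "var_exp r (Yv i) = Poly_Mapping.single (3 * i) 1 + Poly_Mapping.single (3 * r i + 2) 1"

text \<open>A monomial goes to a monomial or to 0, so the kernel can be studied by comparing
  exponents.\<close>

definition mon_image :: "nat set \<Rightarrow> (nat \<Rightarrow> nat) \<Rightarrow> (xy \<Rightarrow>\<^sub>0 nat) \<Rightarrow> ((nat \<Rightarrow>\<^sub>0 nat) \<Rightarrow>\<^sub>0 'k::field)" where
  "mon_image S r m = (if keys m \<inter> vars S = {}
     then Poly_Mapping.single (lin_ext (var_exp r) m) 1 else 0)"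

definition param :: "nat set \<Rightarrow> (nat \<Rightarrow> nat) \<Rightarrow> 'k::field xy_poly \<Rightarrow> ((nat \<Rightarrow>\<^sub>0 nat) \<Rightarrow>\<^sub>0 'k)" where
  "param S r = lin_ext (mon_image S r)"

lemma mon_image_add: "mon_image S r (m + n) = mon_image S r m * mon_image S r n"
  by (auto simp: mon_image_def keys_add_nat lin_ext_add mult_single)

lemma param_add: "param S r (f + f') = param S r f + param S r f'"
  unfolding param_def by (rule lin_ext_add)

lemma param_diff: "param S r (f - f') = param S r f - param S r f'"
  unfolding param_def by (rule lin_ext_diff)

lemma param_mult: "param S r (f * f') = param S r f * param S r f'"
  unfolding param_def by (rule lin_ext_mult) (rule mon_image_add)

lemma param_one [simp]: "param S r 1 = 1"
  unfolding single_one[symmetric] param_def lin_ext_single by (simp add: mon_image_def mult_single)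

lemma param_prod: "param S r (\<Prod>i \<in> A. f i) = (\<Prod>i \<in> A. param S r (f i))"
  by (induction A rule: infinite_finite_induct) (auto simp: param_mult)

lemma param_power: "param S r (f ^ n) = param S r f ^ n"
  by (induction n) (auto simp: param_mult)

lemma param_indet:
  "param S r (indet v :: 'k::field xy_poly) =
     (if v \<in> vars S then 0 else Poly_Mapping.single (var_exp r v) 1)"
  by (simp add: param_def lin_ext_single mon_image_def indet_def del: One_nat_def)

text \<open>Both terms involve \<open>i\<close> and \<open>j\<close>: they vanish if either index is
  in \<open>S\<close>, and otherwise share the image \<open>t_i t_j z_C w_C\<close>.\<close>

lemma param_edge_binomial_eq_0:
  assumes "i \<notin> S \<Longrightarrow> j \<notin> S \<Longrightarrow> r i = r j"
  shows "param S r (edge_binomial i j) = 0"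
  using assms by (auto simp: edge_binomial_def param_diff param_mult param_indet mult_single add_ac)

lemma param_edge_binomial_neq_0:
  assumes "i \<notin> S" "j \<notin> S" "r i \<noteq> r j"
  shows "param S r (edge_binomial i j :: 'k::field xy_poly) \<noteq> 0"
proof
  let ?m = "var_exp r (Xv i) + var_exp r (Yv j)" and ?n = "var_exp r (Xv j) + var_exp r (Yv i)"
  assume "param S r (edge_binomial i j :: 'k xy_poly) = 0"
  then have "Poly_Mapping.single ?m (1::'k) = Poly_Mapping.single ?n 1"
    using assms by (simp add: edge_binomial_def param_diff param_mult param_indet mult_single)
  then have "lookup (Poly_Mapping.single ?m (1::'k)) ?m = lookup (Poly_Mapping.single ?n 1) ?m" by simp
  then have "?m = ?n" by (simp add: lookup_single when_def split: if_splits)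
  \<comment> \<open>The variable \<open>z\<close> of the component of \<open>i\<close> occurs in the
    image of \<open>x_i y_j\<close> but not in that of \<open>x_j y_i\<close>.\<close>
  then have "lookup ?m (3 * r i + 1) = lookup ?n (3 * r i + 1)" by simp
  moreover have "3 * r i + 1 \<noteq> 3 * a" "3 * r i + 1 \<noteq> 3 * a + 2" for a by presburger+
  ultimately show False
    using assms(3) by (auto simp: lookup_add lookup_single when_def split: if_splits)
qed

text \<open>Otherwise the image of \<open>m\<close> would keep the nonzero coefficient of
  \<open>m\<close>.\<close>

lemma param_cancellation:
  assumes "param S r f = 0" "m \<in> keys f" "keys m \<inter> vars S = {}"
  shows "\<exists>m' \<in> keys f. m' \<noteq> m \<and> keys m' \<inter> vars S = {} \<and>
    lin_ext (var_exp r) m' = lin_ext (var_exp r) m"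
proof (rule ccontr)
  assume contra: "\<not> ?thesis"
  let ?u = "lin_ext (var_exp r) m"
  have *: "lookup (mon_image S r m') ?u = 0" if "m' \<in> keys f" "m' \<noteq> m" for m'
    using that contra by (auto simp: mon_image_def lookup_single when_def)
  have "lookup (param S r f) ?u = (\<Sum>m' \<in> keys f. lookup f m' * lookup (mon_image S r m') ?u)"
    unfolding param_def lookup_lin_ext ..
  also have "\<dots> = (\<Sum>m' \<in> {m}. lookup f m' * lookup (mon_image S r m') ?u)"
    by (rule sum.mono_neutral_right) (use assms * in auto)
  also have "\<dots> = lookup f m"
    using assms by (simp add: mon_image_def)
  finally show False using assms by (simp add: in_keys_iff)
qed

lemma lookup_var_exp:
  "lookup (var_exp r v) (3 * a) \<noteq> 0 \<longleftrightarrow> v = Xv a \<or> v = Yv a"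
  "lookup (var_exp r v) (3 * c + 1) \<noteq> 0 \<longleftrightarrow> (\<exists>b. v = Xv b \<and> r b = c)"
  "lookup (var_exp r v) (3 * c + 2) \<noteq> 0 \<longleftrightarrow> (\<exists>b. v = Yv b \<and> r b = c)"
proof -
  have mod: "3 * i \<noteq> 3 * j + (1::nat)" "3 * i \<noteq> 3 * j + (2::nat)" "3 * i + 1 \<noteq> 3 * j + (2::nat)" for i j
    by presburger+
  show "lookup (var_exp r v) (3 * a) \<noteq> 0 \<longleftrightarrow> v = Xv a \<or> v = Yv a"
    "lookup (var_exp r v) (3 * c + 1) \<noteq> 0 \<longleftrightarrow> (\<exists>b. v = Xv b \<and> r b = c)"
    "lookup (var_exp r v) (3 * c + 2) \<noteq> 0 \<longleftrightarrow> (\<exists>b. v = Yv b \<and> r b = c)"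
    using mod mod[symmetric]
    by (cases v; simp add: lookup_add lookup_single when_def del: One_nat_def add_2_eq_Suc' add_2_eq_Suc)+
qed

lemma lookup_lin_ext_var_exp:
  "lookup (lin_ext (var_exp r) m) (3 * a) \<noteq> 0 \<Longrightarrow> Xv a \<in> keys m \<or> Yv a \<in> keys m"
  "lookup (lin_ext (var_exp r) m) (3 * c + 1) \<noteq> 0 \<Longrightarrow> \<exists>b. Xv b \<in> keys m \<and> r b = c"
  "lookup (lin_ext (var_exp r) m) (3 * c + 2) \<noteq> 0 \<Longrightarrow> \<exists>b. Yv b \<in> keys m \<and> r b = c"
  by (erule lookup_lin_ext_neq_0, unfold lookup_var_exp, blast)+

section \<open>Generators of the kernel of the parametrization\<close>

context
  fixes A S :: "nat set" and r :: "nat \<Rightarrow> nat" and I :: "'k::field xy_poly set"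
  assumes zero: "0 \<in> I"
    and add: "\<And>p q. p \<in> I \<Longrightarrow> q \<in> I \<Longrightarrow> p + q \<in> I"
    and mult: "\<And>p m c. p \<in> I \<Longrightarrow> keys m \<subseteq> vars A \<Longrightarrow> Poly_Mapping.single m c * p \<in> I"
    and indets: "\<And>v. v \<in> vars S \<Longrightarrow> indet v \<in> I"
    and binomials: "\<And>a b. a \<in> A - S \<Longrightarrow> b \<in> A - S \<Longrightarrow> r a = r b \<Longrightarrow> edge_binomial a b \<in> I"
begin

text \<open>If the image of \<open>v\<close> divides that of \<open>m\<close>, then \<open>m\<close>
  is congruent modulo \<open>I\<close> to a multiple of \<open>v\<close>. When \<open>v\<close> does
  not divide \<open>m\<close>, one swap \<open>x_b y_a\<close> to \<open>x_a y_b\<close>, or back,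
  inside a component brings it in.\<close>

lemma exchange_variable:
  assumes m: "keys m \<subseteq> vars (A - S)" and v: "v \<in> vars (A - S)"
    and img: "lin_ext (var_exp r) m = u + var_exp r v"
  obtains n where "keys n \<subseteq> vars (A - S)" "lin_ext (var_exp r) n = u"
    "Poly_Mapping.single m 1 - Poly_Mapping.single n 1 * indet v \<in> I"
proof -
  note result = that
  have divisible: thesis if "v \<in> keys m"
  proof -
    obtain n where n: "m = n + Poly_Mapping.single v 1" using \<open>v \<in> keys m\<close> by (rule monomial_split)
    have "lin_ext (var_exp r) n = u"
      using img by (simp add: n lin_ext_add)
    moreover have "Poly_Mapping.single m 1 - Poly_Mapping.single n 1 * indet v = (0 :: 'k xy_poly)"
      by (simp add: n indet_def mult_single)
    ultimately show thesis
      using result[of n] m zero by (simp add: n keys_add_nat)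
  qed
  obtain a where a: "v = Xv a \<or> v = Yv a" by (cases v) auto
  \<comment> \<open>The factor \<open>t_a\<close> of the image shows that \<open>x_a\<close> or
    \<open>y_a\<close> divides \<open>m\<close>.\<close>
  have "lookup (lin_ext (var_exp r) m) (3 * a) \<noteq> 0"
    using a lookup_var_exp(1)[of r v a] by (simp add: img lookup_add)
  then obtain w where w: "w \<in> keys m" "w = Xv a \<or> w = Yv a"
    using lookup_lin_ext_var_exp(1) by blast
  show thesis
  proof (cases "v \<in> keys m")
    case True
    then show thesis by (rule divisible)
  next
    case False
    then have "w \<noteq> v" using w by blast
    from a show thesis
    proof
      assume v_eq: "v = Xv a"
      then have w_eq: "w = Yv a" using w \<open>w \<noteq> v\<close> by blast
      \<comment> \<open>The factor \<open>z\<close> of the component of \<open>a\<close> must come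
        from some \<open>x_b\<close> in that component.\<close>
      have "lookup (var_exp r v) (3 * r a + 1) \<noteq> 0"
        unfolding lookup_var_exp using v_eq by blast
      then have "lookup (lin_ext (var_exp r) m) (3 * r a + 1) \<noteq> 0"
        unfolding img lookup_add by linarith
      then obtain b where b: "Xv b \<in> keys m" "r b = r a"
        using lookup_lin_ext_var_exp(2) by blast
      obtain m1 where m1: "m = m1 + Poly_Mapping.single (Yv a) 1"
        using w(1) unfolding w_eq by (rule monomial_split)
      then have "Xv b \<in> keys m1" using b by (auto simp: keys_add_nat)
      then obtain m2 where m2: "m1 = m2 + Poly_Mapping.single (Xv b) 1" by (rule monomial_split)
      let ?n = "m2 + Poly_Mapping.single (Yv b) 1"
      have "keys ?n \<subseteq> vars (A - S)" using m by (auto simp: m1 m2 keys_add_nat)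
      moreover have "lin_ext (var_exp r) ?n = u"
      proof -
        have "lin_ext (var_exp r) ?n + var_exp r v = u + var_exp r v"
          unfolding img[symmetric] by (simp add: m1 m2 v_eq b(2) lin_ext_add ac_simps)
        then show ?thesis by simp
      qed
      moreover have "Poly_Mapping.single m 1 - Poly_Mapping.single ?n 1 * indet v \<in> I"
      proof -
        have "Poly_Mapping.single m 1 - Poly_Mapping.single ?n 1 * indet v
          = Poly_Mapping.single m2 1 * (edge_binomial b a :: 'k xy_poly)"
          by (simp add: m1 m2 v_eq edge_binomial_def indet_def mult_single right_diff_distrib add_ac)
        also have "\<dots> \<in> I"
          using m b v by (intro mult binomials) (auto simp: m1 m2 v_eq keys_add_nat vars_def)
        finally show ?thesis .
      qed
      ultimately show thesis by (rule that)
    next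
      assume v_eq: "v = Yv a"
      then have w_eq: "w = Xv a" using w \<open>w \<noteq> v\<close> by blast
      have "lookup (var_exp r v) (3 * r a + 2) \<noteq> 0"
        unfolding lookup_var_exp using v_eq by blast
      then have "lookup (lin_ext (var_exp r) m) (3 * r a + 2) \<noteq> 0"
        unfolding img lookup_add by linarith
      then obtain b where b: "Yv b \<in> keys m" "r b = r a"
        using lookup_lin_ext_var_exp(3) by blast
      obtain m1 where m1: "m = m1 + Poly_Mapping.single (Xv a) 1"
        using w(1) unfolding w_eq by (rule monomial_split)
      then have "Yv b \<in> keys m1" using b by (auto simp: keys_add_nat)
      then obtain m2 where m2: "m1 = m2 + Poly_Mapping.single (Yv b) 1" by (rule monomial_split)
      let ?n = "m2 + Poly_Mapping.single (Xv b) 1"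
      have "keys ?n \<subseteq> vars (A - S)" using m by (auto simp: m1 m2 keys_add_nat)
      moreover have "lin_ext (var_exp r) ?n = u"
      proof -
        have "lin_ext (var_exp r) ?n + var_exp r v = u + var_exp r v"
          unfolding img[symmetric] by (simp add: m1 m2 v_eq b(2) lin_ext_add ac_simps)
        then show ?thesis by simp
      qed
      moreover have "Poly_Mapping.single m 1 - Poly_Mapping.single ?n 1 * indet v \<in> I"
      proof -
        have "Poly_Mapping.single m 1 - Poly_Mapping.single ?n 1 * indet v
          = Poly_Mapping.single m2 1 * (edge_binomial a b :: 'k xy_poly)"
          by (simp add: m1 m2 v_eq edge_binomial_def indet_def mult_single right_diff_distrib add_ac)
        also have "\<dots> \<in> I"
          using m b v by (intro mult binomials) (auto simp: m1 m2 v_eq keys_add_nat vars_def)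
        finally show ?thesis .
      qed
      ultimately show thesis by (rule that)
    qed
  qed
qed

text \<open>Split a variable \<open>v\<close> off \<open>m\<close>, exchange it into
  \<open>m'\<close>, and compare the cofactors by induction.\<close>

lemma single_diff_in_if_same_image:
  assumes "keys m \<subseteq> vars (A - S)" "keys m' \<subseteq> vars (A - S)"
    and "lin_ext (var_exp r) m = lin_ext (var_exp r) m'"
  shows "Poly_Mapping.single m 1 - Poly_Mapping.single m' 1 \<in> I"
  using assms
proof (induction m arbitrary: m' rule: monomial_induct)
  case zero
  have "m' = 0"
  proof (rule ccontr)
    assume "m' \<noteq> 0"
    then obtain v where v: "v \<in> keys m'" by (metis all_not_in_conv keys_eq_empty)
    obtain a where a: "v = Xv a \<or> v = Yv a" by (cases v) auto
    obtain n where "m' = n + Poly_Mapping.single v 1" using v by (rule monomial_split)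
    then have "lookup (lin_ext (var_exp r) m') (3 * a) \<noteq> 0"
      using a lookup_var_exp(1)[of r v a] by (simp add: lin_ext_add lookup_add)
    then show False using zero by simp
  qed
  then show ?case using \<open>0 \<in> I\<close> by simp
next
  case (add n v)
  have n: "keys n \<subseteq> vars (A - S)" "v \<in> vars (A - S)" using add.prems by (auto simp: keys_add_nat)
  have "lin_ext (var_exp r) m' = lin_ext (var_exp r) n + var_exp r v"
    using add.prems(3) by (simp add: lin_ext_add)
  then obtain n' where n': "keys n' \<subseteq> vars (A - S)" "lin_ext (var_exp r) n' = lin_ext (var_exp r) n"
    "Poly_Mapping.single m' 1 - Poly_Mapping.single n' 1 * indet v \<in> I"
    using exchange_variable[OF add.prems(2) n(2)] by blast
  let ?p = "Poly_Mapping.single n 1 - Poly_Mapping.single n' 1 :: 'k xy_poly"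
  let ?q = "Poly_Mapping.single m' 1 - Poly_Mapping.single n' 1 * indet v :: 'k xy_poly"
  have "?p \<in> I" using add.IH n n' by simp
  \<comment> \<open>This is \<open>v (n - n') - (m' - n' v) = n v - m'\<close>.\<close>
  then have "indet v * ?p + Poly_Mapping.single 0 (- 1) * ?q \<in> I"
    unfolding indet_def
    by (intro \<open>\<And>p q. p \<in> I \<Longrightarrow> q \<in> I \<Longrightarrow> p + q \<in> I\<close> mult)
       (use n n' in \<open>auto simp: indet_def vars_def\<close>)
  also have "indet v * ?p + Poly_Mapping.single 0 (- 1) * ?q
      = Poly_Mapping.single (n + Poly_Mapping.single v 1) 1 - Poly_Mapping.single m' 1"
    by (simp add: indet_def mult_single algebra_simps single_uminus)
  finally show ?case .
qed

text \<open>Induction on the number of terms: a term meeting \<open>S\<close> is a multiple of a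
  variable of \<open>S\<close>; any other term is traded for a term already present with the same
  image. Later \<open>I\<close> is the set of all \<open>p\<close> with \<open>s * p\<close> in
  \<open>J\<close>.\<close>

lemma param_kernel_subset:
  assumes "\<forall>m \<in> keys f. keys m \<subseteq> vars A" "param S r f = 0"
  shows "f \<in> I"
  using assms
proof (induction "card (keys f)" arbitrary: f rule: less_induct)
  case less
  show ?case
  proof (cases "f = 0")
    case True
    then show ?thesis using zero by simp
  next
    case False
    then obtain m where m: "m \<in> keys f" by (metis all_not_in_conv keys_eq_empty)
    let ?c = "lookup f m"
    have *: "f \<in> I" if q: "q \<in> I" "param S r q = 0" and keys: "keys (f - q) \<subseteq> keys f - {m}" for q
    proof -
      have "card (keys (f - q)) < card (keys f)"
        using keys m by (intro psubset_card_mono) auto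
      moreover have "param S r (f - q) = 0" using less.prems q by (simp add: param_diff)
      ultimately have "f - q \<in> I" using less.hyps less.prems keys by blast
      then have "(f - q) + q \<in> I" using q add by blast
      then show ?thesis by simp
    qed
    show ?thesis
    proof (cases "keys m \<inter> vars S = {}")
      case False
      then obtain v where v: "v \<in> keys m" "v \<in> vars S" by blast
      obtain n where n: "m = n + Poly_Mapping.single v 1" using v(1) by (rule monomial_split)
      show ?thesis
      proof (rule *[of "Poly_Mapping.single m ?c"])
        have "Poly_Mapping.single m ?c = Poly_Mapping.single n ?c * indet v"
          by (simp add: n indet_def mult_single)
        also have "\<dots> \<in> I"
        proof (intro mult indets)
          have "keys n \<subseteq> keys m" by (auto simp: n keys_add_nat)
          then show "keys n \<subseteq> vars A" using less.prems(1) m by blast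
        qed fact
        finally show "Poly_Mapping.single m ?c \<in> I" .
        show "param S r (Poly_Mapping.single m ?c) = 0"
          using False by (simp add: param_def lin_ext_single mon_image_def)
        show "keys (f - Poly_Mapping.single m ?c) \<subseteq> keys f - {m}"
          by (auto simp: in_keys_iff lookup_minus lookup_single when_def split: if_splits)
      qed
    next
      case True
      from param_cancellation[OF less.prems(2) m this] obtain m' where
        m': "m' \<in> keys f" "m' \<noteq> m" "keys m' \<inter> vars S = {}"
        "lin_ext (var_exp r) m' = lin_ext (var_exp r) m" by blast
      have diff: "vars (A - S) = vars A - vars S" by (auto simp: vars_def)
      show ?thesis
      proof (rule *[of "Poly_Mapping.single 0 ?c * (Poly_Mapping.single m 1 - Poly_Mapping.single m' 1)"])
        show "Poly_Mapping.single 0 ?c * (Poly_Mapping.single m 1 - Poly_Mapping.single m' 1) \<in> I"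
          using less.prems m m' True unfolding diff[symmetric]
          by (intro mult single_diff_in_if_same_image) (auto simp: diff)
        show "param S r (Poly_Mapping.single 0 ?c * (Poly_Mapping.single m 1 - Poly_Mapping.single m' 1)) = 0"
          unfolding param_mult param_diff
          using True m' by (simp add: param_def lin_ext_single mon_image_def)
        show "keys (f - Poly_Mapping.single 0 ?c * (Poly_Mapping.single m 1 - Poly_Mapping.single m' 1))
            \<subseteq> keys f - {m}"
          using m m' by (auto simp: in_keys_iff right_diff_distrib mult_single lookup_minus lookup_single when_def
              split: if_splits)
      qed
    qed
  qed
qed

end

text \<open>Expansion of a vanishing 3 by 3 determinant with a repeated row of \<open>x\<close> or
  of \<open>y\<close> variables.\<close>

lemma indet_mult_edge_binomial:
  "indet (Xv t) * edge_binomial u v = indet (Xv v) * edge_binomial u t + indet (Xv u) * edge_binomial t v"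
  "indet (Yv t) * edge_binomial u v = indet (Yv v) * edge_binomial u t + indet (Yv u) * edge_binomial t v"
  by (simp_all add: edge_binomial_def algebra_simps)

text \<open>Taking the kernel instead of an ideal given by generators makes primality
  immediate.\<close>

definition cut_ideal :: "nat \<Rightarrow> nat pair_pre_digraph \<Rightarrow> nat set \<Rightarrow> 'k::field xy_poly set" where
  "cut_ideal d G S = {f \<in> carrier (xy_ring d). param S (component_rep S (parcs G)) f = 0}"

section \<open>Cut ideals as associated primes of the binomial edge ideal\<close>

locale graph_cut_set = pair_graph G for G :: "nat pair_pre_digraph" +
  fixes d :: nat and S :: "nat set" and J :: "'k::field xy_poly set"
  assumes verts: "pverts G = {1..d}" and cut: "cut_set {1..d} (parcs G) S"
    and J_def: "J = binomial_edge_ideal d G"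
begin

abbreviation R :: "'k xy_poly ring" where "R \<equiv> xy_ring d"

abbreviation P :: "'k xy_poly set" where "P \<equiv> cut_ideal d G S"

abbreviation rep :: "nat \<Rightarrow> nat" where "rep \<equiv> component_rep S (parcs G)"

sublocale R: cring R
  by (rule cring_xy_ring)

sublocale J: ideal J R
  unfolding J_def using verts by (intro ideal_binomial_edge_ideal) auto

lemma arcs_subset: "parcs G \<subseteq> {1..d} \<times> {1..d}"
  using wellformed' verts by auto

lemma S_subset: "S \<subseteq> {1..d}"
  using cut by (simp add: cut_set_def)

lemma single_carrier: "keys m \<subseteq> vars {1..d} \<Longrightarrow> Poly_Mapping.single m c \<in> carrier R"
  by (auto simp: carrier_xy_ring vars_def)

lemma indet_carrier: "v \<in> vars {1..d} \<Longrightarrow> indet v \<in> carrier R"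
  unfolding indet_def by (rule single_carrier) simp

lemma mult_carrier: "f \<in> carrier R \<Longrightarrow> g \<in> carrier R \<Longrightarrow> f * g \<in> carrier R"
  using R.m_closed[of f g] by simp

lemma diff_carrier:
  assumes "f \<in> carrier R" "g \<in> carrier R"
  shows "f - g \<in> carrier R"
proof -
  have "Poly_Mapping.single 0 (- 1) \<in> carrier R" by (rule single_carrier) simp
  then have "f + Poly_Mapping.single 0 (- 1) * g \<in> carrier R"
    using R.a_closed[of f] mult_carrier assms by simp
  then show ?thesis by (simp add: single_uminus)
qed

lemma one_carrier: "1 \<in> carrier R"
  using R.one_closed by simp

lemma prod_carrier: "(\<And>i. i \<in> A \<Longrightarrow> f i \<in> carrier R) \<Longrightarrow> (\<Prod>i \<in> A. f i) \<in> carrier R"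
  by (induction A rule: infinite_finite_induct) (auto intro: mult_carrier one_carrier)

lemma power_carrier: "f \<in> carrier R \<Longrightarrow> f ^ n \<in> carrier R"
  by (induction n) (auto intro: mult_carrier one_carrier)

lemma edge_binomial_carrier: "a \<in> {1..d} \<Longrightarrow> b \<in> {1..d} \<Longrightarrow> edge_binomial a b \<in> carrier R"
  unfolding edge_binomial_def by (intro diff_carrier mult_carrier indet_carrier) auto

lemma J_add: "f \<in> J \<Longrightarrow> g \<in> J \<Longrightarrow> f + g \<in> J"
  using J.a_closed[of f g] by simp

lemma J_mult: "f \<in> carrier R \<Longrightarrow> g \<in> J \<Longrightarrow> f * g \<in> J"
  using J.I_l_closed[of g f] by simp

lemma J_zero: "0 \<in> J"
  using J.zero_closed by simp

lemma generators_eq: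
  "{indet (Xv i) * indet (Yv j) - indet (Xv j) * indet (Yv i) | i j. (i, j) \<in> parcs G}
     = {edge_binomial i j :: 'k xy_poly | i j. (i, j) \<in> parcs G}"
  by (simp add: edge_binomial_def)

lemma edge_binomial_in_J:
  assumes "(a, b) \<in> parcs G"
  shows "edge_binomial a b \<in> J"
proof -
  have "{edge_binomial i j | i j. (i, j) \<in> parcs G} \<subseteq> carrier R"
    using arcs_subset edge_binomial_carrier by auto
  from R.genideal_self[OF this] show ?thesis
    using assms unfolding J_def binomial_edge_ideal_def generators_eq by blast
qed

text \<open>The kernel of a homomorphism into an integral domain is prime.\<close>

lemma primeideal_cut_ideal: "primeideal P R"
proof -
  let ?T = "ring_of_type_algebra :: ((nat \<Rightarrow>\<^sub>0 nat) \<Rightarrow>\<^sub>0 'k) ring"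
  have "param S rep \<in> ring_hom R ?T"
    by (rule ring_hom_memI) (simp_all add: ring_of_type_algebra_def param_mult param_add)
  then have "ring_hom_ring R ?T (param S rep)"
    by (intro ring_hom_ringI2 R.ring_axioms ring_from_type_algebra)
  then have "ideal (a_kernel R ?T (param S rep)) R"
    by (rule ring_hom_ring.kernel_is_ideal)
  also have "a_kernel R ?T (param S rep) = P"
    by (simp add: a_kernel_def' cut_ideal_def ring_of_type_algebra_def)
  finally show ?thesis
  proof (rule primeidealI)
    show "cring R" by (rule R.is_cring)
    have "1 \<notin> P" by (simp add: cut_ideal_def)
    then show "carrier R \<noteq> P" using one_carrier by blast
    fix f g assume "f \<in> carrier R" "g \<in> carrier R" "f \<otimes>\<^bsub>R\<^esub> g \<in> P"
    then show "f \<in> P \<or> g \<in> P"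
      by (auto simp: cut_ideal_def param_mult)
  qed
qed

lemma rep_eq_iff: "rep a = rep b \<longleftrightarrow> (a, b) \<in> (avoiding S (parcs G))\<^sup>*"
  by (rule component_rep_eq_iff) (intro sym_parcs, unfold_locales)

lemma J_subset_cut_ideal: "J \<subseteq> P"
proof -
  have "edge_binomial a b \<in> P" if "(a, b) \<in> parcs G" for a b
  proof -
    have "rep a = rep b" if "a \<notin> S" "b \<notin> S"
      unfolding rep_eq_iff using that \<open>(a, b) \<in> parcs G\<close> by (auto simp: avoiding_def)
    moreover have "edge_binomial a b \<in> carrier R"
      using that arcs_subset by (intro edge_binomial_carrier) auto
    ultimately show ?thesis
      by (simp add: cut_ideal_def param_edge_binomial_eq_0)
  qed
  then show ?thesis
    unfolding J_def binomial_edge_ideal_def generators_eq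
    by (intro R.genideal_minimal primeideal.axioms(1)[OF primeideal_cut_ideal]) auto
qed

definition xprod :: "'k xy_poly" where
  "xprod = (\<Prod>c \<in> {1..d} - S. indet (Xv c))"

lemma xprod_carrier: "xprod \<in> carrier R"
  unfolding xprod_def by (intro prod_carrier indet_carrier) auto

text \<open>Each edge of the path costs one factor \<open>xprod\<close>: its factor
  \<open>x_c\<close>, for the last vertex \<open>c\<close> before \<open>b\<close>, splits
  \<open>f_ab\<close> into multiples of \<open>f_ac\<close> and \<open>f_cb\<close>.\<close>

lemma path_binomial_in_J:
  assumes "a \<in> {1..d}" "(a, b) \<in> avoiding S (parcs G) ^^ n"
  shows "xprod ^ n * edge_binomial a b \<in> J \<and> b \<in> {1..d}"
  using assms(2)
proof (induction n arbitrary: b)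
  case 0
  then show ?case using J_zero assms by (simp add: edge_binomial_def)
next
  case (Suc n)
  then obtain c where c: "(a, c) \<in> avoiding S (parcs G) ^^ n" "(c, b) \<in> avoiding S (parcs G)"
    by auto
  then have cb: "(c, b) \<in> parcs G" "c \<in> {1..d} - S" "b \<in> {1..d}"
    using arcs_subset by (auto simp: avoiding_def)
  let ?x = "\<Prod>c \<in> {1..d} - S - {c}. indet (Xv c) :: 'k xy_poly"
  \<comment> \<open>Here \<open>c\<close> lies outside \<open>S\<close>, so \<open>x_c\<close>
    divides \<open>xprod\<close>.\<close>
  have xprod: "xprod = indet (Xv c) * ?x"
    unfolding xprod_def by (rule prod.remove) (use cb in auto)
  have "xprod ^ Suc n * edge_binomial a b = ?x * xprod ^ n * (indet (Xv c) * edge_binomial a b)"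
    by (simp add: xprod mult_ac)
  also have "\<dots> = ?x * indet (Xv b) * (xprod ^ n * edge_binomial a c)
      + ?x * xprod ^ n * indet (Xv a) * edge_binomial c b"
    unfolding indet_mult_edge_binomial(1)[of c a b] by (simp only: distrib_left mult_ac)
  also have "\<dots> \<in> J"
  proof (rule J_add)
    have x: "?x \<in> carrier R" by (intro prod_carrier indet_carrier) auto
    show "?x * indet (Xv b) * (xprod ^ n * edge_binomial a c) \<in> J"
      using Suc.IH[OF c(1)] cb
      by (intro J_mult[of "?x * indet (Xv b)"] mult_carrier x indet_carrier) auto
    show "?x * xprod ^ n * indet (Xv a) * edge_binomial c b \<in> J"
      using edge_binomial_in_J[OF cb(1)] assms(1)
      by (intro J_mult mult_carrier x power_carrier xprod_carrier indet_carrier) auto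
  qed
  finally show ?case using cb by simp
qed

lemma ex_cut_multiplier:
  obtains s where "s \<in> carrier R" "param S rep s \<noteq> 0"
    "\<And>v. v \<in> vars S \<Longrightarrow> s * indet v \<in> J"
    "\<And>a b. a \<in> {1..d} \<Longrightarrow> rep a = rep b \<Longrightarrow> s * edge_binomial a b \<in> J"
proof -
  obtain u v where uv: "\<And>t. t \<in> S \<Longrightarrow> (t, u t) \<in> parcs G \<and> (t, v t) \<in> parcs G \<and> u t \<notin> S \<and> v t \<notin> S
      \<and> (u t, v t) \<notin> (avoiding S (parcs G))\<^sup>*"
    using cut unfolding cut_set_def by metis
  have uv_verts: "u t \<in> {1..d}" "v t \<in> {1..d}" if "t \<in> S" for t
    using uv[OF that] arcs_subset by auto
  have finS: "finite S" using S_subset finite_subset by blast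
  let ?E = "avoiding S (parcs G)"
  have finE: "finite ?E"
    by (rule finite_subset[OF _ pair_finite_arcs]) (auto simp: avoiding_def)
  define q :: "'k xy_poly" where "q = (\<Prod>t \<in> S. edge_binomial (u t) (v t))"
  \<comment> \<open>Connected vertices are joined by a path of at most \<open>card ?E\<close> steps,
    so this exponent suffices for all pairs.\<close>
  define s where "s = xprod ^ card ?E * q"
  have q_carrier: "q \<in> carrier R"
    unfolding q_def by (intro prod_carrier edge_binomial_carrier uv_verts)
  show thesis
  proof (rule that[of s])
    show "s \<in> carrier R"
      unfolding s_def by (intro mult_carrier power_carrier xprod_carrier q_carrier)
    show "param S rep s \<noteq> 0"
    proof -
      have "param S rep (edge_binomial (u t) (v t) :: 'k xy_poly) \<noteq> 0" if "t \<in> S" for t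
        using uv[OF that] by (intro param_edge_binomial_neq_0) (auto simp: rep_eq_iff)
      then show ?thesis
        using finS by (simp add: s_def q_def xprod_def param_mult param_power param_prod param_indet)
    qed
    show "s * indet w \<in> J" if w: "w \<in> vars S" for w
    proof -
      obtain t where t: "t \<in> S" "w = Xv t \<or> w = Yv t" using w by (auto simp: vars_def)
      let ?q = "\<Prod>t \<in> S - {t}. edge_binomial (u t) (v t) :: 'k xy_poly"
      have q: "q = edge_binomial (u t) (v t) * ?q"
        unfolding q_def by (rule prod.remove) (use t finS in auto)
      have arcs: "(u t, t) \<in> parcs G" "(t, v t) \<in> parcs G"
        using uv[OF t(1)] sym_parcs[of G] pair_graph by (auto dest: symD)
      \<comment> \<open>The product splits into multiples of the generators for the two arcs at
        \<open>t\<close>.\<close>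
      have "indet w * edge_binomial (u t) (v t) \<in> J"
        using t(2)
      proof (elim disjE)
        assume w: "w = Xv t"
        show ?thesis
          unfolding w indet_mult_edge_binomial(1)[of t "u t"] using arcs uv_verts[OF t(1)]
          by (intro J_add J_mult indet_carrier edge_binomial_in_J) auto
      next
        assume w: "w = Yv t"
        show ?thesis
          unfolding w indet_mult_edge_binomial(2)[of t "u t"] using arcs uv_verts[OF t(1)]
          by (intro J_add J_mult indet_carrier edge_binomial_in_J) auto
      qed
      then have "xprod ^ card ?E * ?q * (indet w * edge_binomial (u t) (v t)) \<in> J"
        using uv_verts
        by (intro J_mult[of "xprod ^ card ?E * ?q"] mult_carrier power_carrier xprod_carrier prod_carrier
            edge_binomial_carrier) auto
      then show ?thesis by (simp add: s_def q mult_ac)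
    qed
    show "s * edge_binomial a b \<in> J" if a: "a \<in> {1..d}" and ab: "rep a = rep b" for a b
    proof -
      have "(a, b) \<in> ?E\<^sup>*" using ab unfolding rep_eq_iff .
      then obtain n where n: "n \<le> card ?E" "(a, b) \<in> ?E ^^ n"
        using rtrancl_finite_eq_relpow[OF finE] by auto
      have "q * xprod ^ (card ?E - n) * (xprod ^ n * edge_binomial a b) \<in> J"
        using path_binomial_in_J[OF a n(2)] q_carrier
        by (intro J_mult[of "q * xprod ^ (card ?E - n)"] mult_carrier power_carrier xprod_carrier) auto
      also have "q * xprod ^ (card ?E - n) * (xprod ^ n * edge_binomial a b)
          = (xprod ^ (card ?E - n) * xprod ^ n) * q * edge_binomial a b"
        by (simp only: mult_ac)
      also have "\<dots> = s * edge_binomial a b"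
        using n(1) by (simp add: s_def flip: power_add)
      finally show ?thesis .
    qed
  qed
qed

lemma cut_ideal_in_Ass: "P \<in> Ass R (quotient_module R J)"
proof -
  obtain s where s: "s \<in> carrier R" "param S rep s \<noteq> 0"
    "\<And>v. v \<in> vars S \<Longrightarrow> s * indet v \<in> J"
    "\<And>a b. a \<in> {1..d} \<Longrightarrow> rep a = rep b \<Longrightarrow> s * edge_binomial a b \<in> J"
    by (rule ex_cut_multiplier) blast
  show ?thesis
  proof (rule R.annihilator_in_Ass[OF J.is_ideal primeideal_cut_ideal s(1)])
    show "P = {f \<in> carrier R. f \<otimes>\<^bsub>R\<^esub> s \<in> J}"
    proof (intro Set.set_eqI iffI)
      fix f assume f: "f \<in> P"
      \<comment> \<open>\<open>(J : s)\<close> contains the generators of the kernel, hence all of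
        \<open>P\<close>.\<close>
      have "f \<in> {p. s * p \<in> J}"
      proof (rule param_kernel_subset)
        show "0 \<in> {p. s * p \<in> J}" using J_zero by simp
        show "p + q \<in> {p. s * p \<in> J}" if "p \<in> {p. s * p \<in> J}" "q \<in> {p. s * p \<in> J}" for p q
          using that J_add by (simp add: distrib_left)
        show "Poly_Mapping.single m c * p \<in> {p. s * p \<in> J}"
          if "p \<in> {p. s * p \<in> J}" "keys m \<subseteq> vars {1..d}" for p m c
          using that J_mult[OF single_carrier[of m c], of "s * p"] by (simp add: mult.left_commute)
        show "\<forall>m \<in> keys f. keys m \<subseteq> vars {1..d}"
          using f by (simp add: cut_ideal_def carrier_xy_ring vars_def)
        show "param S rep f = 0" using f by (simp add: cut_ideal_def)
      qed (use s in auto)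
      then show "f \<in> {f \<in> carrier R. f \<otimes>\<^bsub>R\<^esub> s \<in> J}"
        using f by (simp add: cut_ideal_def mult.commute)
    next
      fix f assume f: "f \<in> {f \<in> carrier R. f \<otimes>\<^bsub>R\<^esub> s \<in> J}"
      \<comment> \<open>Conversely, \<open>s\<close> lies outside the prime \<open>P\<close>, so it
        can be cancelled.\<close>
      then have "f * s \<in> P" using J_subset_cut_ideal by auto
      then show "f \<in> P"
        using f s(2) by (auto simp: cut_ideal_def param_mult)
    qed
  qed
qed

end

text \<open>\<open>S\<close> consists of the vertices \<open>i\<close> with \<open>x_i\<close> in
  the cut ideal.\<close>

lemma cut_ideal_inj:
  assumes "S \<subseteq> {1..d}" "T \<subseteq> {1..d}" "cut_ideal d G S = (cut_ideal d G T :: 'k::field xy_poly set)"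
  shows "S = T"
proof -
  have mem: "i \<in> S \<longleftrightarrow> (indet (Xv i) :: 'k xy_poly) \<in> cut_ideal d G S" if "i \<in> {1..d}" for i S
    using indet_in_xy_ring[OF that] by (auto simp: cut_ideal_def param_indet)
  have "i \<in> S \<longleftrightarrow> i \<in> T" if "i \<in> {1..d}" for i
    unfolding mem[OF that] assms(3) ..
  then show ?thesis using assms(1,2) by auto
qed

theorem proposition4p11:
  fixes p d :: nat
    and G :: "nat pair_pre_digraph"
  assumes "Factorial_Ring.prime p" and "CHAR('k::field) = p"
    and "F_finite TYPE('k)"
    and "pair_graph G" and "pverts G = {1..d}"
    and "Digraph_Component.connected (with_proj G)"
    and "card (Ass (xy_ring d :: 'k xy_poly ring)
                   (quotient_module (xy_ring d) (binomial_edge_ideal d G))) = 2"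
  shows "weakly_closed G"
proof (rule weakly_closed_if_unique_cut_set[OF assms(4-6)])
  fix S T
  assume S: "cut_set {1..d} (parcs G) S" "S \<noteq> {}" and T: "cut_set {1..d} (parcs G) T" "T \<noteq> {}"
  let ?Ass = "Ass (xy_ring d :: 'k xy_poly ring) (quotient_module (xy_ring d) (binomial_edge_ideal d G))"
  let ?P = "cut_ideal d G :: nat set \<Rightarrow> 'k xy_poly set"
  have Ass: "?P U \<in> ?Ass" if "cut_set {1..d} (parcs G) U" for U
  proof -
    interpret graph_cut_set G d U "binomial_edge_ideal d G :: 'k xy_poly set"
      using assms(4,5) that by (simp add: graph_cut_set_def graph_cut_set_axioms_def)
    show ?thesis by (rule cut_ideal_in_Ass)
  qed
  have sub: "{?P {}, ?P S, ?P T} \<subseteq> ?Ass"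
    using Ass S T cut_set_empty by blast
  \<comment> \<open>An infinite set would have cardinality 0.\<close>
  have "finite ?Ass" using assms(7) by (intro card_ge_0_finite) simp
  then have card: "card {?P {}, ?P S, ?P T} \<le> 2"
    using card_mono[OF _ sub] assms(7) by simp
  show "S = T"
  proof (rule ccontr)
    assume "S \<noteq> T"
    have inj: "?P U \<noteq> ?P W"
      if "cut_set {1..d} (parcs G) U" "cut_set {1..d} (parcs G) W" "U \<noteq> W" for U W
      using that cut_ideal_inj[of U d W G] unfolding cut_set_def by blast
    have "?P {} \<noteq> ?P S" "?P {} \<noteq> ?P T" "?P S \<noteq> ?P T"
      using inj[OF cut_set_empty S(1) S(2)[symmetric]] inj[OF cut_set_empty T(1) T(2)[symmetric]]
        inj[OF S(1) T(1) \<open>S \<noteq> T\<close>] by blast+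
    then show False using card by simp
  qed
qed

end
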